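(* Let $f^- : \bar{X} \to \bar{Y}$ be an arrow in the category $\mathbf{Prob}$, let $u \in \mathcal{L}^1(\bar{Y})$ and $v \in \mathcal{L}^\infty(\bar{Y})$, and assume that $v$ is $f^-$-measurable. Then $$E^{f^-}(v \cdot u) \sim_{\mathbb{P}_X} w \cdot E^{f^-}(u),$$ where $w \in \mathcal{L}^\infty(\bar{X})$ is a random variable satisfying $v \sim_{\mathbb{P}_Y} w \circ f$.
   Context: The category $\mathbf{Prob}$ has all probability spaces $\bar{X} = (X,\Sigma_X,\mathbb{P}_X)$ as objects; an arrow $f^- : \bar{X} \to \bar{Y}$ is a symbol corresponding uniquely to a measurable function $f : Y \to X$ (note the reversed direction) that is null-preserving, i.e. $\mathbb{P}_X(A)=0$ implies $\mathbb{P}_Y(f^{-1}(A))=0$ for $A \in \Sigma_X$. $\mathcal{L}^1(\bar{X})$ is the vector space of $\mathbb{R}$-valued random variables on $\bar{X}$ integrable with respect to $\mathbb{P}_X$; $\mathcal{L}^\infty(\bar{X})$ is the vector space of $\mathbb{R}$-valued random variables on $\bar{X}$ with finite $\mathbb{P}_X$-essential supremum of the absolute value. For random variables, $u_1 \sim_{\mathbb{P}_X} u_2$ means $\mathbb{P}_X(u_1 \ne u_2) = 0$. Conditional expectation along an arrow: for $f^- : \bar{X} \to \bar{Y}$ in $\mathbf{Prob}$ and $v \in \mathcal{L}^1(\bar{Y})$, $E^{f^-}(v)$ denotes the element of $\mathcal{L}^1(\bar{X})$, unique up to $\mathbb{P}_X$-a.s. equality (it exists by the Radon-Nikodym theorem),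 such that $\int_A E^{f^-}(v)\, d\mathbb{P}_X = \int_{f^{-1}(A)} v \, d\mathbb{P}_Y$ for all $A \in \Sigma_X$. A random variable $v \in \mathcal{L}^\infty(\bar{Y})$ is called $f^-$-measurable if there exists $w \in \mathcal{L}^\infty(\bar{X})$ such that $v \sim_{\mathbb{P}_Y} w \circ f$. *)

theory Defs
  imports "HOL-Probability.Probability"
begin

text \<open>The objects of the category Prob are the measures \<open>X\<close> with \<open>prob_space X\<close>. The function \<open>f\<close>
  representing an arrow from \<open>X\<close> to \<open>Y\<close> goes in the opposite direction, from \<open>Y\<close> to \<open>X\<close>.\<close>

definition Prob_arrow :: "'a measure \<Rightarrow> 'b measure \<Rightarrow> ('b \<Rightarrow> 'a) \<Rightarrow> bool" where
  "Prob_arrow X Y f \<longleftrightarrow>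
     prob_space X \<and> prob_space Y \<and> f \<in> Y \<rightarrow>\<^sub>M X \<and>
     (\<forall>A\<in>sets X. measure X A = 0 \<longrightarrow> measure Y (f -` A \<inter> space Y) = 0)"

definition L1 :: "'a measure \<Rightarrow> ('a \<Rightarrow> real) set" where
  "L1 X = {u. integrable X u}"

definition Linf :: "'a measure \<Rightarrow> ('a \<Rightarrow> real) set" where
  "Linf X = {u. u \<in> borel_measurable X \<and> esssup X (\<lambda>x. ereal \<bar>u x\<bar>) < \<infinity>}"

definition is_cond_exp ::
  "'a measure \<Rightarrow> 'b measure \<Rightarrow> ('b \<Rightarrow> 'a) \<Rightarrow> ('b \<Rightarrow> real) \<Rightarrow> ('a \<Rightarrow> real) \<Rightarrow> bool" where
  "is_cond_exp X Y f v g \<longleftrightarrow>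
     g \<in> L1 X \<and> (\<forall>A\<in>sets X. (LINT x:A|X. g x) = (LINT y:(f -` A \<inter> space Y)|Y. v y))"

text \<open>An arbitrary version of the conditional expectation along the arrow. A version exists and is
  unique up to almost sure equality; see \<open>ex_is_cond_exp\<close> and \<open>is_cond_exp_unique\<close> below.\<close>

definition cond_exp_along ::
  "'a measure \<Rightarrow> 'b measure \<Rightarrow> ('b \<Rightarrow> 'a) \<Rightarrow> ('b \<Rightarrow> real) \<Rightarrow> 'a \<Rightarrow> real" where
  "cond_exp_along X Y f v = (SOME g. is_cond_exp X Y f v g)"

definition arrow_measurable ::
  "'a measure \<Rightarrow> 'b measure \<Rightarrow> ('b \<Rightarrow> 'a) \<Rightarrow> ('b \<Rightarrow> real) \<Rightarrow> bool" where
  "arrow_measurable X Y f v \<longleftrightarrow> (\<exists>w\<in>Linf X. AE y in Y. v y = (w \<circ> f) y)"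

lemma ex_is_cond_exp_nonneg:
  assumes f: "Prob_arrow X Y f" and v: "integrable Y v" and nn: "\<And>y. 0 \<le> v y"
  shows "\<exists>g. is_cond_exp X Y f v g"
proof -
  interpret X: prob_space X using f by (simp add: Prob_arrow_def)
  interpret Y: prob_space Y using f by (simp add: Prob_arrow_def)
  have [measurable]: "f \<in> Y \<rightarrow>\<^sub>M X" using f by (simp add: Prob_arrow_def)
  have [measurable]: "v \<in> borel_measurable Y" using v by auto
  define N where "N = distr (density Y (\<lambda>y. ennreal (v y))) X f"
  have sN[measurable_cong]: "sets N = sets X" by (simp add: N_def)
  have emN: "emeasure N A = ennreal (LINT y:(f -` A \<inter> space Y)|Y. v y)" if [measurable]: "A \<in> sets X" for A
  proof -
    have "emeasure N A = (\<integral>\<^sup>+y. ennreal (v y) * indicator (f -` A \<inter> space Y) y \<partial>Y)"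
      by (simp add: N_def emeasure_distr emeasure_density)
    also have "\<dots> = (\<integral>\<^sup>+y. ennreal (indicator (f -` A \<inter> space Y) y *\<^sub>R v y) \<partial>Y)"
      by (intro nn_integral_cong) (auto simp: indicator_def)
    also have "\<dots> = ennreal (LINT y:(f -` A \<inter> space Y)|Y. v y)"
      unfolding set_lebesgue_integral_def using v nn
      by (intro nn_integral_eq_integral integrable_mult_indicator) auto
    finally show ?thesis .
  qed
  have "absolutely_continuous X N"
    unfolding absolutely_continuous_def
  proof
    fix A assume A: "A \<in> null_sets X"
    then have [measurable]: "A \<in> sets X" by auto
    from A have "measure X A = 0" by (simp add: measure_def null_sets_def)
    then have "measure Y (f -` A \<inter> space Y) = 0" using f \<open>A \<in> sets X\<close> by (simp add: Prob_arrow_def)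
    then have "f -` A \<inter> space Y \<in> null_sets Y" by (simp add: null_sets_def Y.emeasure_eq_measure)
    then have "f -` A \<inter> space Y \<in> null_sets (density Y (\<lambda>y. ennreal (v y)))"
      using absolutely_continuousI_density[of "\<lambda>y. ennreal (v y)" Y]
      by (auto simp: absolutely_continuous_def)
    then show "A \<in> null_sets N"
      by (auto simp: N_def null_sets_def emeasure_distr)
  qed
  then obtain g where [measurable]: "g \<in> borel_measurable X" and g: "density X g = N"
    using X.Radon_Nikodym sN by blast
  have gA: "(\<integral>\<^sup>+x. g x * indicator A x \<partial>X) = ennreal (LINT y:(f -` A \<inter> space Y)|Y. v y)"
    if "A \<in> sets X" for A
    using emN[OF that] that by (simp add: g[symmetric] emeasure_density)
  have "(\<integral>\<^sup>+x. g x \<partial>X) = (\<integral>\<^sup>+x. g x * indicator (space X) x \<partial>X)"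
    by (intro nn_integral_cong) auto
  then have fin: "(\<integral>\<^sup>+x. g x \<partial>X) < \<infinity>" using gA[of "space X"] by simp
  then have AEfin: "AE x in X. g x \<noteq> \<infinity>"
    by (intro nn_integral_PInf_AE) auto
  define h where "h x = enn2real (g x)" for x
  have hnn: "0 \<le> h x" for x by (simp add: h_def)
  have [measurable]: "h \<in> borel_measurable X" unfolding h_def by measurable
  have hg: "AE x in X. ennreal (h x) = g x"
    using AEfin by eventually_elim (simp add: h_def ennreal_enn2real less_top)
  have "(\<integral>\<^sup>+x. ennreal (h x) \<partial>X) = (\<integral>\<^sup>+x. g x \<partial>X)"
    using hg by (intro nn_integral_cong_AE) auto
  then have ih: "integrable X h"
    using fin by (intro integrableI_nonneg) (auto simp: h_def)
  have "(LINT x:A|X. h x) = (LINT y:(f -` A \<inter> space Y)|Y. v y)" if A[measurable]: "A \<in> sets X" for A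
  proof -
    have p1: "0 \<le> (LINT x:A|X. h x)"
      unfolding set_lebesgue_integral_def by (intro Bochner_Integration.integral_nonneg) (auto simp: h_def)
    have p2: "0 \<le> (LINT y:(f -` A \<inter> space Y)|Y. v y)"
      unfolding set_lebesgue_integral_def by (intro Bochner_Integration.integral_nonneg) (auto simp: nn)
    have "ennreal (LINT x:A|X. h x) = (\<integral>\<^sup>+x. ennreal (indicator A x *\<^sub>R h x) \<partial>X)"
      unfolding set_lebesgue_integral_def using ih
      by (intro nn_integral_eq_integral[symmetric] integrable_mult_indicator) (auto simp: hnn)
    also have "\<dots> = (\<integral>\<^sup>+x. g x * indicator A x \<partial>X)"
      by (intro nn_integral_cong_AE) (use hg in \<open>eventually_elim, auto simp: indicator_def\<close>)
    also have "\<dots> = ennreal (LINT y:(f -` A \<inter> space Y)|Y. v y)" by (rule gA[OF A])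
    finally show ?thesis using p1 p2 by simp
  qed
  with ih show ?thesis by (auto simp: is_cond_exp_def L1_def)
qed

lemma ex_is_cond_exp:
  assumes f: "Prob_arrow X Y f" and v: "v \<in> L1 Y"
  shows "\<exists>g. is_cond_exp X Y f v g"
proof -
  have [measurable]: "f \<in> Y \<rightarrow>\<^sub>M X" using f by (simp add: Prob_arrow_def)
  have iv: "integrable Y v" using v by (simp add: L1_def)
  let ?p = "\<lambda>y. max 0 (v y)" and ?n = "\<lambda>y. max 0 (- v y)"
  have ip: "integrable Y ?p" and inn: "integrable Y ?n" using iv by auto
  obtain g where g: "is_cond_exp X Y f ?p g" using ex_is_cond_exp_nonneg[OF f ip] by auto
  obtain h where h: "is_cond_exp X Y f ?n h" using ex_is_cond_exp_nonneg[OF f inn] by auto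
  have ig: "integrable X g" and ih: "integrable X h"
    using g h by (auto simp: is_cond_exp_def L1_def)
  have "(LINT x:A|X. g x - h x) = (LINT y:(f -` A \<inter> space Y)|Y. v y)" if [measurable]: "A \<in> sets X" for A
  proof -
    let ?B = "f -` A \<inter> space Y"
    have B: "?B \<in> sets Y" by measurable
    have si: "set_integrable X A g" "set_integrable X A h" "set_integrable Y ?B ?p" "set_integrable Y ?B ?n"
      unfolding set_integrable_def using ig ih ip inn B
      by (auto intro!: integrable_mult_indicator simp del: integrable_max real_scaleR_def)
    have "(LINT x:A|X. g x - h x) = (LINT x:A|X. g x) - (LINT x:A|X. h x)"
      using si by (intro set_integral_diff) auto
    also have "\<dots> = (LINT y:?B|Y. ?p y) - (LINT y:?B|Y. ?n y)"
      using g h that by (simp add: is_cond_exp_def)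
    also have "\<dots> = (LINT y:?B|Y. ?p y - ?n y)"
      using si by (intro set_integral_diff(2)[symmetric]) auto
    also have "(\<lambda>y. ?p y - ?n y) = v" by (auto simp: max_def)
    finally show ?thesis .
  qed
  with ig ih show ?thesis
    by (intro exI[of _ "\<lambda>x. g x - h x"]) (auto simp: is_cond_exp_def L1_def)
qed

lemma is_cond_exp_unique:
  assumes "is_cond_exp X Y f v g" "is_cond_exp X Y f v h"
  shows "AE x in X. g x = h x"
  using assms by (intro density_unique_real) (auto simp: is_cond_exp_def L1_def)

lemma is_cond_exp_cond_exp_along:
  assumes "Prob_arrow X Y f" "v \<in> L1 Y"
  shows "is_cond_exp X Y f v (cond_exp_along X Y f v)"
  unfolding cond_exp_along_def using ex_is_cond_exp[OF assms] by (rule someI_ex)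

end

theory Submission
  imports Defs
begin

text \<open>The defining property of the conditional expectation \<open>g\<close> of \<open>u\<close> says that
  \<open>\<integral> \<phi> g = \<integral> (\<phi> \<circ> f) u\<close> for indicators \<open>\<phi>\<close>; linearity and dominated convergence extend it to all
  bounded measurable \<open>\<phi>\<close>. Taking for \<open>\<phi>\<close> the product of the indicator of \<open>A\<close> with a bounded
  representative of \<open>w\<close> shows that \<open>w g\<close> is a conditional expectation of \<open>(w \<circ> f) u\<close>. Null-preservation
  makes \<open>(w \<circ> f) u\<close> independent, up to null sets, of the representative.\<close>

lemma integrable_mult_bounded:
  fixes g h :: "'a \<Rightarrow> real"
  assumes g: "integrable M g" and [measurable]: "h \<in> borel_measurable M"
    and bound: "AE x in M. \<bar>h x\<bar> \<le> C"
  shows "integrable M (\<lambda>x. h x * g x)"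
proof (rule Bochner_Integration.integrable_bound)
  show "integrable M (\<lambda>x. C * g x)" using g by simp
  have [measurable]: "g \<in> borel_measurable M" using g by auto
  show "(\<lambda>x. h x * g x) \<in> borel_measurable M" by measurable
  show "AE x in M. norm (h x * g x) \<le> norm (C * g x)"
    using bound by eventually_elim (auto simp: abs_mult intro!: mult_right_mono)
qed

lemma Linf_AE_bounded:
  fixes M :: "'a measure" and u :: "'a \<Rightarrow> real"
  assumes "u \<in> Linf M"
  obtains C :: real where "0 \<le> C" "AE x in M. \<bar>u x\<bar> \<le> C"
proof -
  let ?s = "esssup M (\<lambda>x. ereal \<bar>u x\<bar>)"
  have "?s < \<infinity>" using assms by (simp add: Linf_def)
  then obtain C where C: "?s \<le> ereal C" by (cases ?s) auto
  \<comment> \<open>On the zero measure \<open>?s\<close> is -\<infinity> and \<open>C\<close> may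
    be negative, so \<open>max 0 C\<close> secures a nonnegative bound.\<close>
  have "AE x in M. \<bar>u x\<bar> \<le> max 0 C"
    using esssup_AE[of "\<lambda>x. ereal \<bar>u x\<bar>" M]
  proof eventually_elim
    case (elim x)
    then have "ereal \<bar>u x\<bar> \<le> ereal C" using C by (rule order_trans)
    then show ?case by simp
  qed
  then show ?thesis by (intro that[of "max 0 C"]) auto
qed

lemma integrable_mult_Linf:
  assumes "u \<in> L1 M" "v \<in> Linf M"
  shows "integrable M (\<lambda>x. v x * u x)"
proof -
  obtain C where "AE x in M. \<bar>v x\<bar> \<le> C" by (rule Linf_AE_bounded[OF assms(2)])
  then show ?thesis
    using assms by (intro integrable_mult_bounded) (auto simp: L1_def Linf_def)
qed

text \<open>Null-preservation is what makes this work: \<open>P\<close> fails inside a measurable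
  null set, and the preimage of that set is null in \<open>Y\<close>.\<close>

lemma AE_Prob_arrow:
  assumes f: "Prob_arrow X Y f" and P: "AE x in X. P x"
  shows "AE y in Y. P (f y)"
proof -
  interpret X: prob_space X using f by (simp add: Prob_arrow_def)
  interpret Y: prob_space Y using f by (simp add: Prob_arrow_def)
  have fm: "f \<in> Y \<rightarrow>\<^sub>M X" using f by (simp add: Prob_arrow_def)
  from P obtain N where N: "{x \<in> space X. \<not> P x} \<subseteq> N" "emeasure X N = 0" "N \<in> sets X"
    by (rule AE_E)
  then have "measure Y (f -` N \<inter> space Y) = 0"
    using f by (simp add: Prob_arrow_def measure_def)
  then have "f -` N \<inter> space Y \<in> null_sets Y"
    using measurable_sets[OF fm N(3)] by (simp add: null_sets_def Y.emeasure_eq_measure)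
  then show ?thesis
    by (rule AE_I') (use N(1) measurable_space[OF fm] in auto)
qed

text \<open>Induction on \<open>\<phi>\<close> from indicators, where the claim is the defining
  property of \<open>g\<close>. Since \<open>u\<close> and \<open>g\<close> are merely integrable,
  the bound on \<open>\<phi>\<close> is what keeps the products integrable.\<close>

lemma is_cond_exp_integral_nonneg:
  assumes fm: "f \<in> Y \<rightarrow>\<^sub>M X" and u: "integrable Y u" and g: "is_cond_exp X Y f u g"
    and \<phi>: "\<phi> \<in> borel_measurable X" "\<And>x. 0 \<le> \<phi> x" "\<And>x. x \<in> space X \<Longrightarrow> \<phi> x \<le> C"
  shows "(LINT x|X. \<phi> x * g x) = (LINT y|Y. \<phi> (f y) * u y)"
proof -
  have ig: "integrable X g" using g by (simp add: is_cond_exp_def L1_def)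
  note [measurable] = fm borel_measurable_integrable[OF u] borel_measurable_integrable[OF ig]
  have int: "integrable X (\<lambda>x. h x * g x)" "integrable Y (\<lambda>y. h (f y) * u y)"
    if [measurable]: "h \<in> borel_measurable X" and "\<And>x. 0 \<le> h x" "\<And>x. x \<in> space X \<Longrightarrow> h x \<le> D"
    for h D
    using that measurable_space[OF fm]
    by (auto intro!: integrable_mult_bounded[OF ig, where C=D] integrable_mult_bounded[OF u, where C=D])
  \<comment> \<open>The bound varies along the induction, hence \<open>C\<close> is quantified
    inside. It is restricted to \<open>space X\<close> because the limits in the monotone case are
    given only there.\<close>
  have "\<forall>C. (\<forall>x\<in>space X. \<phi> x \<le> C) \<longrightarrow> (LINT x|X. \<phi> x * g x) = (LINT y|Y. \<phi> (f y) * u y)"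
    using \<phi>(1,2)
  proof (induction rule: borel_measurable_induct_real)
    case (set A)
    have "(LINT y|Y. indicator A (f y) * u y) = (LINT y:(f -` A \<inter> space Y)|Y. u y)"
      unfolding set_lebesgue_integral_def
      by (intro Bochner_Integration.integral_cong) (auto simp: indicator_def)
    then show ?case
      using g set by (simp add: is_cond_exp_def set_lebesgue_integral_def)
  next
    case (mult h c)
    show ?case
    \<comment> \<open>A bound on \<open>c * h\<close> bounds \<open>h\<close> only if
      \<open>c\<close> is nonzero; otherwise both integrals vanish.\<close>
    proof (cases "c = 0")
      case False
      show ?thesis
      proof (intro allI impI)
        fix C assume "\<forall>x\<in>space X. c * h x \<le> C"
        then have "\<forall>x\<in>space X. h x \<le> C / c"
          using False mult.hyps(1) by (simp add: field_simps)
        then have "(LINT x|X. h x * g x) = (LINT y|Y. h (f y) * u y)"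
          using mult.IH by blast
        then show "(LINT x|X. c * h x * g x) = (LINT y|Y. c * h (f y) * u y)"
          by (simp add: mult.assoc)
      qed
    qed simp
  next
    case (add h k)
    show ?case
    proof (intro allI impI)
      fix C assume C: "\<forall>x\<in>space X. k x + h x \<le> C"
      \<comment> \<open>Each summand inherits the bound \<open>C\<close> because the other one is
        nonnegative.\<close>
      have hb: "h x \<le> C" and kb: "k x \<le> C" if "x \<in> space X" for x
        using C[rule_format, OF that] add.hyps(2)[of x] add.hyps(4)[of x] by linarith+
      show "(LINT x|X. (k x + h x) * g x) = (LINT y|Y. (k (f y) + h (f y)) * u y)"
      proof -
        have "(LINT x|X. h x * g x) = (LINT y|Y. h (f y) * u y)"
          "(LINT x|X. k x * g x) = (LINT y|Y. k (f y) * u y)"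
          using add.IH hb kb by blast+
        then show ?thesis
          using int[OF add.hyps(1,2) hb] int[OF add.hyps(3,4) kb] by (simp add: distrib_right)
      qed
    qed
  next
    case (seq U)
    have [measurable]: "U i \<in> borel_measurable X" for i by (rule seq.hyps(1))
    note [measurable] = \<phi>(1)
    show ?case
    proof (intro allI impI)
      fix C assume C: "\<forall>x\<in>space X. \<phi> x \<le> C"
      have UC: "U i x \<le> C" if "x \<in> space X" for i x
      proof -
        have "incseq (\<lambda>i. U i x)"
          using seq.hyps(3) by (auto simp: incseq_def le_fun_def)
        from incseq_le[OF this seq.hyps(4)[OF that]] show ?thesis
          using C that by (meson order_trans)
      qed
      \<comment> \<open>Since \<open>0 \<le> U i x \<le> C\<close>, the functions
        \<open>\<bar>C * g x\<bar>\<close> and \<open>\<bar>C * u y\<bar>\<close> dominate both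
        sequences of products.\<close>
      have bd: "\<bar>U i x * a\<bar> \<le> \<bar>C * a\<bar>" if "x \<in> space X" for i x a
        using UC[OF that, of i] seq.hyps(2)[of i x] by (simp add: abs_mult mult_right_mono)
      have "(\<lambda>i. LINT x|X. U i x * g x) \<longlonglongrightarrow> (LINT x|X. \<phi> x * g x)"
        by (rule integral_dominated_convergence[where w="\<lambda>x. \<bar>C * g x\<bar>"])
          (use ig bd in \<open>auto intro!: AE_I2 tendsto_mult_right seq.hyps(4)\<close>)
      moreover have "(\<lambda>i. LINT y|Y. U i (f y) * u y) \<longlonglongrightarrow> (LINT y|Y. \<phi> (f y) * u y)"
        by (rule integral_dominated_convergence[where w="\<lambda>y. \<bar>C * u y\<bar>"])
          (use u bd measurable_space[OF fm] in \<open>auto intro!: AE_I2 tendsto_mult_right seq.hyps(4)\<close>)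
      moreover have "(LINT x|X. U i x * g x) = (LINT y|Y. U i (f y) * u y)" for i
        using seq.IH UC by blast
      ultimately show "(LINT x|X. \<phi> x * g x) = (LINT y|Y. \<phi> (f y) * u y)"
        using LIMSEQ_unique by auto
    qed
  qed
  then show ?thesis using \<phi>(3) by blast
qed

text \<open>Adding \<open>C\<close> to \<open>\<phi>\<close> makes it nonnegative with bound
  \<open>2 * C\<close>; subtracting the formula for the constant \<open>C\<close> then leaves the
  one for \<open>\<phi>\<close>.\<close>

lemma is_cond_exp_integral:
  assumes fm: "f \<in> Y \<rightarrow>\<^sub>M X" and u: "integrable Y u" and g: "is_cond_exp X Y f u g"
    and \<phi>[measurable]: "\<phi> \<in> borel_measurable X" and bound: "\<And>x. \<bar>\<phi> x\<bar> \<le> C"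
  shows "(LINT x|X. \<phi> x * g x) = (LINT y|Y. \<phi> (f y) * u y)"
proof -
  have ig: "integrable X g" using g by (simp add: is_cond_exp_def L1_def)
  note [measurable] = fm
  have C: "0 \<le> C" "0 \<le> \<phi> x + C" "\<phi> x + C \<le> 2 * C" for x
    using bound[of x] by linarith+
  have "(LINT x|X. (\<phi> x + C) * g x) = (LINT y|Y. (\<phi> (f y) + C) * u y)"
    by (rule is_cond_exp_integral_nonneg[OF fm u g, where C="2 * C"]) (use C in auto)
  moreover have "(LINT x|X. C * g x) = (LINT y|Y. C * u y)"
    by (rule is_cond_exp_integral_nonneg[OF fm u g, where C=C]) (use C in auto)
  moreover have "integrable X (\<lambda>x. \<phi> x * g x)" "integrable Y (\<lambda>y. \<phi> (f y) * u y)"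
    by (auto intro!: integrable_mult_bounded[OF ig, where C=C] integrable_mult_bounded[OF u, where C=C] bound)
  ultimately show ?thesis
    using ig u by (simp add: distrib_right del: integral_mult_right_zero)
qed

text \<open>The pull-out rule for an arbitrary version \<open>g\<close>; uniqueness of versions then
  transfers it to the chosen ones.\<close>

lemma is_cond_exp_mult:
  assumes f: "Prob_arrow X Y f" and u: "u \<in> L1 Y" and g: "is_cond_exp X Y f u g"
    and v[measurable]: "v \<in> borel_measurable Y" and w: "w \<in> Linf X"
    and vw: "AE y in Y. v y = w (f y)"
  shows "is_cond_exp X Y f (\<lambda>y. v y * u y) (\<lambda>x. w x * g x)"
proof -
  have fm[measurable]: "f \<in> Y \<rightarrow>\<^sub>M X" using f by (simp add: Prob_arrow_def)
  have iu: "integrable Y u" using u by (simp add: L1_def)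
  have gL: "g \<in> L1 X" using g by (simp add: is_cond_exp_def)
  have [measurable]: "w \<in> borel_measurable X" using w by (simp add: Linf_def)
  note [measurable] = borel_measurable_integrable[OF iu]
  have [measurable]: "g \<in> borel_measurable X" using gL by (auto simp: L1_def)
  obtain C where C: "0 \<le> C" "AE x in X. \<bar>w x\<bar> \<le> C" by (rule Linf_AE_bounded[OF w])
  \<comment> \<open>\<open>w\<close> is bounded only almost everywhere, whereas the integral formula
    takes test functions bounded at every point. Clipping to [-C, C] alters \<open>w\<close> on a
    null set only.\<close>
  define w' where "w' x = max (- C) (min C (w x))" for x
  have [measurable]: "w' \<in> borel_measurable X" unfolding w'_def by measurable
  have ww': "AE x in X. w x = w' x"
    using C(2) by eventually_elim (auto simp: w'_def)
  have vw': "AE y in Y. v y = w' (f y)"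
    using vw AE_Prob_arrow[OF f ww'] by eventually_elim simp
  have "(LINT x:A|X. w x * g x) = (LINT y:(f -` A \<inter> space Y)|Y. v y * u y)"
    if [measurable]: "A \<in> sets X" for A
  proof -
    have "(LINT x:A|X. w x * g x) = (LINT x|X. (indicator A x * w' x) * g x)"
      unfolding set_lebesgue_integral_def
      by (intro integral_cong_AE) (use ww' in \<open>auto elim!: eventually_mono\<close>)
    also have "\<dots> = (LINT y|Y. (indicator A (f y) * w' (f y)) * u y)"
      by (rule is_cond_exp_integral[OF fm iu g, where C=C])
        (use C(1) in \<open>auto simp: w'_def indicator_def\<close>)
    also have "\<dots> = (LINT y:(f -` A \<inter> space Y)|Y. v y * u y)"
      unfolding set_lebesgue_integral_def
    proof (intro integral_cong_AE)
      show "AE y in Y. indicator A (f y) * w' (f y) * u y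
              = indicator (f -` A \<inter> space Y) y *\<^sub>R (v y * u y)"
        using vw' AE_space by eventually_elim (auto simp: indicator_def)
    qed measurable
    finally show ?thesis .
  qed
  moreover have "integrable X (\<lambda>x. w x * g x)" using gL w by (rule integrable_mult_Linf)
  ultimately show ?thesis by (simp add: is_cond_exp_def L1_def)
qed

theorem theorem4p4:
  fixes X :: "'a measure" and Y :: "'b measure" and f :: "'b \<Rightarrow> 'a"
    and u v :: "'b \<Rightarrow> real"
  assumes "Prob_arrow X Y f"
    and "u \<in> L1 Y" and "v \<in> Linf Y"
    and "arrow_measurable X Y f v"
  shows "\<forall>w\<in>Linf X. (AE y in Y. v y = (w \<circ> f) y) \<longrightarrow>
           (AE x in X. cond_exp_along X Y f (\<lambda>y. v y * u y) x = w x * cond_exp_along X Y f u x)"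
proof (intro ballI impI)
  fix w assume w: "w \<in> Linf X" and vw: "AE y in Y. v y = (w \<circ> f) y"
  have "(\<lambda>y. v y * u y) \<in> L1 Y"
    using integrable_mult_Linf[OF assms(2,3)] by (simp add: L1_def)
  \<comment> \<open>Integrability of the product guarantees that a version exists, so the choice in
    \<open>cond_exp_along\<close> is indeed a version.\<close>
  then have "is_cond_exp X Y f (\<lambda>y. v y * u y) (cond_exp_along X Y f (\<lambda>y. v y * u y))"
    by (rule is_cond_exp_cond_exp_along[OF assms(1)])
  moreover have "is_cond_exp X Y f (\<lambda>y. v y * u y) (\<lambda>x. w x * cond_exp_along X Y f u x)"
    using assms(3) w vw
    by (intro is_cond_exp_mult[OF assms(1,2) is_cond_exp_cond_exp_along[OF assms(1,2)]])
      (auto simp: Linf_def)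
  ultimately show "AE x in X. cond_exp_along X Y f (\<lambda>y. v y * u y) x = w x * cond_exp_along X Y f u x"
    by (rule is_cond_exp_unique)
qed

end
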